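(* Let $\mathcal{H}$ be a complex Hilbert space, let $A\in\mathcal{B}(\mathcal{H})$ and let $0<t<1$. Then \[\frac{1}{4t(1-t)}\left(\left(\mathfrak{R}_tA\right)^2-\mathfrak{R}_t\left(A^2\right)\right)=\left(\mathfrak{I}A\right)^2.\] In particular, \[(\mathfrak{R}A)^2-\mathfrak{R}\left(A^2\right)=(\mathfrak{I}A)^2.\]
   Context: $\mathcal{B}(\mathcal{H})$ is the $C^*$-algebra of bounded linear operators on the complex Hilbert space $\mathcal{H}$. $\mathfrak{R}A=\frac{A+A^*}{2}$ and $\mathfrak{I}A=\frac{A-A^*}{2\mathrm{i}}$. For $0\le t\le 1$, the weighted real part of $A$ is $\mathfrak{R}_tA=(1-t)A^*+tA$; in particular $\mathfrak{R}_t(A^2)=(1-t)(A^* )^2+tA^2$. *)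

theory Defs
  imports Complex_Main
begin

class complex_vector = ab_group_add +
  fixes scaleC :: "complex \<Rightarrow> 'a \<Rightarrow> 'a" (infixr "*\<^sub>C" 75)
  assumes scaleC_add_right: "c *\<^sub>C (x + y) = c *\<^sub>C x + c *\<^sub>C y"
    and scaleC_add_left: "(c + d) *\<^sub>C x = c *\<^sub>C x + d *\<^sub>C x"
    and scaleC_scaleC: "c *\<^sub>C d *\<^sub>C x = (c * d) *\<^sub>C x"
    and scaleC_one: "1 *\<^sub>C x = x"

text \<open>
  A complex Hilbert space. The inner product is linear in its first argument. Completeness
  comes from \<^class>\<open>banach\<close>; positive definiteness of the inner product follows from
  \<open>norm_cinner\<close> and the axioms for the norm.
\<close>

class complex_hilbert = complex_vector + banach +
  fixes cinner :: "'a \<Rightarrow> 'a \<Rightarrow> complex"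
  assumes scaleR_scaleC: "r *\<^sub>R x = complex_of_real r *\<^sub>C x"
    and cinner_add_left: "cinner (x + y) z = cinner x z + cinner y z"
    and cinner_scaleC_left: "cinner (c *\<^sub>C x) y = c * cinner x y"
    and cinner_commute: "cinner x y = cnj (cinner y x)"
    and norm_cinner: "complex_of_real ((norm x)\<^sup>2) = cinner x x"

instantiation complex :: complex_hilbert
begin

definition scaleC_complex :: "complex \<Rightarrow> complex \<Rightarrow> complex"
  where "scaleC_complex c x = c * x"

definition cinner_complex :: "complex \<Rightarrow> complex \<Rightarrow> complex"
  where "cinner_complex x y = x * cnj y"

instance
  by standard
    (auto simp: scaleC_complex_def cinner_complex_def algebra_simps scaleR_conv_of_real
      complex_norm_square simp del: of_real_power)

end

lemma scaleC_zero_right [simp]: "c *\<^sub>C (0 :: 'a::complex_vector) = 0"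
  using scaleC_add_right[of c "0::'a" 0] by simp

lemma scaleC_minus_right: "c *\<^sub>C (- x) = - (c *\<^sub>C (x :: 'a::complex_vector))"
  using scaleC_add_right[of c x "- x"] by (simp add: eq_neg_iff_add_eq_0 add.commute)

lemma scaleC_diff_right: "c *\<^sub>C (x - y) = c *\<^sub>C x - c *\<^sub>C (y :: 'a::complex_vector)"
  using scaleC_add_right[of c x "- y"] by (simp add: scaleC_minus_right)

lemma norm_scaleC: "norm (c *\<^sub>C x) = cmod c * norm (x :: 'a::complex_hilbert)"
proof -
  have "cinner (c *\<^sub>C x) (c *\<^sub>C x) = c * cnj c * cinner x x"
    using cinner_commute[of x "c *\<^sub>C x"] cinner_commute[of x x]
    by (simp add: cinner_scaleC_left)
  then have "complex_of_real ((norm (c *\<^sub>C x))\<^sup>2) = complex_of_real ((cmod c * norm x)\<^sup>2)"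
    by (simp only: norm_cinner[symmetric] complex_norm_square[symmetric]
        power_mult_distrib of_real_mult)
  then have "(norm (c *\<^sub>C x))\<^sup>2 = (cmod c * norm x)\<^sup>2"
    by (simp only: of_real_eq_iff)
  then show ?thesis
    by (rule power2_eq_imp_eq) auto
qed

lemma bounded_linear_scaleC: "bounded_linear (\<lambda>x :: 'a::complex_hilbert. c *\<^sub>C x)"
  by (rule bounded_linear_intro[where K = "cmod c"])
    (auto simp: scaleC_add_right scaleR_scaleC scaleC_scaleC norm_scaleC mult.commute)

typedef (overloaded) 'a bounded_op =
  "{f :: 'a::complex_hilbert \<Rightarrow> 'a. bounded_linear f \<and> (\<forall>c x. f (c *\<^sub>C x) = c *\<^sub>C f x)}"
  morphisms op_apply Bounded_op
  by (rule exI[of _ "\<lambda>x. x"]) (simp add: bounded_linear_ident)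

setup_lifting type_definition_bounded_op

instantiation bounded_op :: (complex_hilbert) "{complex_vector, ring, monoid_mult}"
begin

lift_definition zero_bounded_op :: "'a bounded_op" is "\<lambda>x. 0"
  by simp

lift_definition one_bounded_op :: "'a bounded_op" is "\<lambda>x. x"
  by (simp add: bounded_linear_ident)

lift_definition plus_bounded_op :: "'a bounded_op \<Rightarrow> 'a bounded_op \<Rightarrow> 'a bounded_op"
  is "\<lambda>f g x. f x + g x"
  by (simp add: bounded_linear_add scaleC_add_right)

lift_definition uminus_bounded_op :: "'a bounded_op \<Rightarrow> 'a bounded_op"
  is "\<lambda>f x. - f x"
  by (simp add: bounded_linear_minus scaleC_minus_right)

lift_definition minus_bounded_op :: "'a bounded_op \<Rightarrow> 'a bounded_op \<Rightarrow> 'a bounded_op"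
  is "\<lambda>f g x. f x - g x"
  by (simp add: bounded_linear_sub scaleC_diff_right)

lift_definition times_bounded_op :: "'a bounded_op \<Rightarrow> 'a bounded_op \<Rightarrow> 'a bounded_op"
  is "\<lambda>f g x. f (g x)"
  by (simp add: bounded_linear_compose)

lift_definition scaleC_bounded_op :: "complex \<Rightarrow> 'a bounded_op \<Rightarrow> 'a bounded_op"
  is "\<lambda>c f x. c *\<^sub>C f x"
  by (simp add: bounded_linear_compose[OF bounded_linear_scaleC] scaleC_scaleC mult.commute)

instance
  by standard
    (transfer; simp add: fun_eq_iff scaleC_add_right scaleC_add_left scaleC_scaleC scaleC_one
      linear_add bounded_linear.linear)+

end

text \<open>By the Riesz representation theorem exactly one operator satisfies the description.\<close>

definition op_adj :: "'a::complex_hilbert bounded_op \<Rightarrow> 'a bounded_op" where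
  "op_adj A = (THE B. \<forall>x y. cinner (op_apply A x) y = cinner x (op_apply B y))"

definition op_Re :: "'a::complex_hilbert bounded_op \<Rightarrow> 'a bounded_op" where
  "op_Re A = (1 / 2) *\<^sub>C (A + op_adj A)"

definition op_Im :: "'a::complex_hilbert bounded_op \<Rightarrow> 'a bounded_op" where
  "op_Im A = (1 / (2 * \<i>)) *\<^sub>C (A - op_adj A)"

definition weighted_Re :: "real \<Rightarrow> 'a::complex_hilbert bounded_op \<Rightarrow> 'a bounded_op" where
  "weighted_Re t A = complex_of_real (1 - t) *\<^sub>C op_adj A + complex_of_real t *\<^sub>C A"

end

theory Submission
  imports Defs
begin

text \<open>
  Once the adjoint is known to be an anti-homomorphism, the claim is an identity in the algebra
  generated by \<open>A\<close> and its adjoint. Since \<open>op_adj\<close> is a definite description, this needs the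
  existence of the adjoint, hence the Riesz representation theorem. The real part \<open>g\<close> of a bounded
  functional is represented by the minimiser of \<open>J x = (norm x)\<^sup>2 - 2 * g x\<close>: by the parallelogram
  law a minimising sequence is Cauchy, and the first variation of \<open>J\<close> vanishes at its limit.
\<close>

section \<open>The inner product\<close>

lemma cinner_add_right: "cinner x (y + z) = cinner x y + cinner x (z :: 'a::complex_hilbert)"
  by (simp only: cinner_commute[of x] cinner_add_left complex_cnj_add)

lemma cinner_scaleC_right: "cinner x (c *\<^sub>C y) = cnj c * cinner x (y :: 'a::complex_hilbert)"
  by (simp only: cinner_commute[of x] cinner_scaleC_left complex_cnj_mult)

lemma cinner_scaleR_left: "cinner (r *\<^sub>R x) y = r *\<^sub>R cinner x (y :: 'a::complex_hilbert)"
  by (simp only: scaleR_scaleC[where 'a = 'a] cinner_scaleC_left scaleR_conv_of_real)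

lemma cinner_scaleR_right: "cinner x (r *\<^sub>R y) = of_real r * cinner x (y :: 'a::complex_hilbert)"
  by (simp add: scaleR_scaleC cinner_scaleC_right)

lemma cinner_diff_right: "cinner x (y - z) = cinner x y - cinner x (z :: 'a::complex_hilbert)"
  using cinner_add_right[of x "y - z" z] by simp

text \<open>Testing against \<open>y - z\<close> makes its squared norm vanish. This uniqueness
  later gives both linearity and uniqueness of the adjoint.\<close>

lemma cinner_right_ext:
  fixes y z :: "'a::complex_hilbert"
  assumes "\<And>x. cinner x y = cinner x z"
  shows "y = z"
proof -
  have "complex_of_real ((norm (y - z))\<^sup>2) = 0"
    unfolding norm_cinner by (simp add: cinner_diff_right assms)
  then show ?thesis by simp
qed

lemma norm_add_power2:
  fixes x y :: "'a::complex_hilbert"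
  shows "(norm (x + y))\<^sup>2 = (norm x)\<^sup>2 + (norm y)\<^sup>2 + 2 * Re (cinner x y)"
proof -
  have "Re (complex_of_real ((norm (x + y))\<^sup>2))
      = Re (complex_of_real ((norm x)\<^sup>2)) + Re (complex_of_real ((norm y)\<^sup>2))
        + (Re (cinner x y) + Re (cinner y x))"
    unfolding norm_cinner by (simp add: cinner_add_left cinner_add_right)
  moreover have "Re (cinner y x) = Re (cinner x y)"
    by (subst cinner_commute) simp
  ultimately show ?thesis by (simp only: Re_complex_of_real)
qed

lemma parallelogram_law:
  fixes x y :: "'a::complex_hilbert"
  shows "(norm (x + y))\<^sup>2 + (norm (x - y))\<^sup>2 = 2 * (norm x)\<^sup>2 + 2 * (norm y)\<^sup>2"
proof -
  have "cinner x (- y) = - cinner x y"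
    using cinner_scaleR_right[of x "-1" y] by simp
  then show ?thesis
    using norm_add_power2[of x y] norm_add_power2[of x "- y"] by simp
qed

text \<open>The triangle inequality is part of the norm axioms, so squaring it already yields
  Cauchy--Schwarz for the real part.\<close>

lemma cmod_cinner_le: "cmod (cinner x y) \<le> norm x * norm (y :: 'a::complex_hilbert)"
proof -
  have re: "Re (cinner u y) \<le> norm u * norm y" for u
  proof -
    have "(norm (u + y))\<^sup>2 \<le> (norm u + norm y)\<^sup>2"
      by (intro power_mono norm_triangle_ineq) simp
    then show ?thesis
      by (simp add: norm_add_power2 power2_sum)
  qed
  \<comment> \<open>A phase factor that rotates \<open>cinner x y\<close> onto the nonnegative real
    axis, so the bound on real parts applies to \<open>c *\<^sub>C x\<close>.\<close>
  define c where "c = cnj (sgn (cinner x y))"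
  have "c * cinner x y = of_real (cmod (cinner x y))"
    by (cases "cinner x y = 0")
      (simp_all add: c_def sgn_eq field_simps complex_norm_square[symmetric] power2_eq_square)
  then have "cmod (cinner x y) = Re (cinner (c *\<^sub>C x) y)"
    by (simp add: cinner_scaleC_left)
  also have "\<dots> \<le> cmod c * norm x * norm y"
    using re[of "c *\<^sub>C x"] by (simp add: norm_scaleC)
  also have "\<dots> \<le> norm x * norm y"
    by (auto simp: c_def norm_sgn)
  finally show ?thesis .
qed

lemma bounded_linear_cinner_left: "bounded_linear (\<lambda>x :: 'a::complex_hilbert. cinner x y)"
  by (rule bounded_linear_intro[where K = "norm y"])
    (simp_all add: cinner_add_left cinner_scaleR_left cmod_cinner_le)

section \<open>Riesz representation and the adjoint\<close>

lemma linear_term_eq_0: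
  fixes a b :: real
  assumes "\<And>s. 0 \<le> s\<^sup>2 * a + s * b"
  shows "b = 0"
proof -
  have "a \<ge> 0"
    using assms[of 1] assms[of "-1"] by simp
  \<comment> \<open>Near the minimiser of the quadratic in \<open>s\<close>; the denominator
    \<open>a + 1\<close> stays positive even if \<open>a = 0\<close>, and the value is minus a
    square.\<close>
  have "0 \<le> (- b / (a + 1))\<^sup>2 * a + (- b / (a + 1)) * b"
    by (rule assms)
  also have "\<dots> = - (b / (a + 1))\<^sup>2"
    using \<open>a \<ge> 0\<close> by (simp add: divide_simps power2_eq_square) (simp add: algebra_simps)
  finally show ?thesis
    using \<open>a \<ge> 0\<close> by simp
qed

lemma riesz_representation_Re:
  fixes g :: "'a::complex_hilbert \<Rightarrow> real"
  assumes "bounded_linear g"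
  shows "\<exists>z. \<forall>x. g x = Re (cinner x z)"
proof -
  interpret g: bounded_linear g by fact
  define J where "J x = (norm x)\<^sup>2 - 2 * g x" for x
  obtain K where K: "\<And>x. norm (g x) \<le> norm x * K"
    using g.bounded by blast
  have bdd: "bdd_below (range J)"
  proof (rule bdd_belowI2)
    fix x
    \<comment> \<open>Completing the square: \<open>J x\<close> is at least
      \<open>(norm x - K)\<^sup>2 - K\<^sup>2\<close>.\<close>
    have "g x \<le> norm x * K" using K[of x] by simp
    moreover have "0 \<le> (norm x - K)\<^sup>2" by simp
    ultimately show "- K\<^sup>2 \<le> J x"
      by (simp add: J_def power2_diff algebra_simps)
  qed
  define m where "m = Inf (range J)"
  have m_le: "m \<le> J x" for x
    unfolding m_def by (rule cInf_lower[OF _ bdd]) simp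
  have "\<exists>x. J x < m + inverse (real (Suc n))" for n
    using cInf_lessD[of "range J" "m + inverse (real (Suc n))"] by (auto simp: m_def)
  then obtain X where X: "\<And>n. J (X n) < m + inverse (real (Suc n))"
    by metis
  have dist: "(norm (x - y))\<^sup>2 \<le> 2 * (J x - m) + 2 * (J y - m)" for x y
  proof -
    \<comment> \<open>By the parallelogram law the squared distance is
      \<open>2 * J x + 2 * J y\<close> minus four times \<open>J\<close> at the midpoint, which is
      at least \<open>m\<close>.\<close>
    have "(norm ((1 / 2) *\<^sub>R (x + y)))\<^sup>2 = (norm (x + y))\<^sup>2 / 4"
      by (simp add: power_divide)
    then have "4 * J ((1 / 2) *\<^sub>R (x + y)) = (norm (x + y))\<^sup>2 - 4 * g x - 4 * g y"
      by (simp only: J_def g.scaleR g.add) (simp add: field_simps)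
    then show ?thesis
      using m_le[of "(1 / 2) *\<^sub>R (x + y)"] parallelogram_law[of x y] by (simp add: J_def)
  qed
  have "Cauchy X"
  proof (rule CauchyI)
    fix e :: real
    assume "e > 0"
    \<comment> \<open>Two excesses over \<open>m\<close>, each below a quarter of
      \<open>e\<^sup>2\<close> and doubled in \<open>dist\<close>, add up to less than
      \<open>e\<^sup>2\<close>.\<close>
    then obtain N where N: "inverse (real (Suc N)) < e\<^sup>2 / 4"
      using reals_Archimedean[of "e\<^sup>2 / 4"] by auto
    have small: "J (X n) - m < e\<^sup>2 / 4" if "n \<ge> N" for n
    proof -
      have "inverse (real (Suc n)) \<le> inverse (real (Suc N))"
        using that by (intro le_imp_inverse_le) auto
      then show ?thesis using X[of n] N by linarith
    qed
    have "norm (X i - X j) < e" if "i \<ge> N" "j \<ge> N" for i j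
    proof (rule power2_less_imp_less)
      show "(norm (X i - X j))\<^sup>2 < e\<^sup>2"
        using dist[of "X i" "X j"] small[OF that(1)] small[OF that(2)] by (simp add: field_simps)
    qed (use \<open>e > 0\<close> in simp)
    then show "\<exists>M. \<forall>i\<ge>M. \<forall>j\<ge>M. norm (X i - X j) < e"
      by blast
  qed
  then obtain z where z: "X \<longlonglongrightarrow> z"
    using Cauchy_convergent convergent_def by blast
  have "(\<lambda>n. J (X n)) \<longlonglongrightarrow> J z"
    unfolding J_def by (intro tendsto_intros g.tendsto z)
  moreover have "(\<lambda>n. m + inverse (real (Suc n))) \<longlonglongrightarrow> m"
    using LIMSEQ_inverse_real_of_nat_add[of m] by simp
  ultimately have "J z \<le> m"
    by (rule LIMSEQ_le) (use X less_imp_le in blast)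
  then have min: "J z \<le> J x" for x
    using m_le[of x] by simp
  have "g x = Re (cinner x z)" for x
  proof -
    have "0 \<le> s\<^sup>2 * (norm x)\<^sup>2 + s * (2 * (Re (cinner z x) - g x))" for s
    proof -
      have "J (z + s *\<^sub>R x) = J z + s\<^sup>2 * (norm x)\<^sup>2 + s * (2 * (Re (cinner z x) - g x))"
        by (simp add: J_def norm_add_power2 cinner_scaleR_right g.add g.scaleR
            algebra_simps)
      then show ?thesis using min[of "z + s *\<^sub>R x"] by linarith
    qed
    then have "2 * (Re (cinner z x) - g x) = 0"
      by (rule linear_term_eq_0)
    then show ?thesis
      using cinner_commute[of x z] by simp
  qed
  then show ?thesis by blast
qed

text \<open>A complex-linear functional is determined by its real part, since
  \<open>Im (f x)\<close> is minus the real part of \<open>f\<close> at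
  \<open>\<i> *\<^sub>C x\<close>.\<close>

lemma riesz_representation:
  fixes f :: "'a::complex_hilbert \<Rightarrow> complex"
  assumes "bounded_linear f" and scaleC: "\<And>c x. f (c *\<^sub>C x) = c * f x"
  shows "\<exists>z. \<forall>x. f x = cinner x z"
proof -
  have "bounded_linear (\<lambda>x. Re (f x))"
    by (rule bounded_linear_compose[OF bounded_linear_Re assms(1)])
  then obtain z where z: "\<And>x. Re (f x) = Re (cinner x z)"
    using riesz_representation_Re by blast
  have "Im (f x) = Im (cinner x z)" for x
    using z[of "\<i> *\<^sub>C x"] by (simp add: scaleC cinner_scaleC_left)
  with z show ?thesis by (auto simp: complex_eq_iff)
qed

lemma bounded_linear_op_apply: "bounded_linear (op_apply A)"
  using op_apply[of A] by simp

lemma op_apply_scaleC: "op_apply A (c *\<^sub>C x) = c *\<^sub>C op_apply A x"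
  using op_apply[of A] by simp

text \<open>Riesz, applied for each \<open>y\<close>, yields a map \<open>B\<close>. Uniqueness of
  representing vectors makes it linear, and Cauchy-Schwarz transfers the bound of \<open>A\<close>
  to it.\<close>

lemma adjoint_exists:
  fixes A :: "'a::complex_hilbert bounded_op"
  shows "\<exists>B. \<forall>x y. cinner (op_apply A x) y = cinner x (op_apply B y)"
proof -
  have "\<exists>z. \<forall>x. cinner (op_apply A x) y = cinner x z" for y
    by (rule riesz_representation)
      (auto simp: op_apply_scaleC cinner_scaleC_left
        intro!: bounded_linear_compose[OF bounded_linear_cinner_left] bounded_linear_op_apply)
  then obtain B where B: "\<And>x y. cinner (op_apply A x) y = cinner x (B y)"
    by metis
  have add: "B (x + y) = B x + B y" for x y
    by (rule cinner_right_ext) (simp add: cinner_add_right flip: B)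
  have scale: "B (c *\<^sub>C x) = c *\<^sub>C B x" for c x
    by (rule cinner_right_ext) (simp add: cinner_scaleC_right flip: B)
  obtain K where K: "\<And>x. norm (op_apply A x) \<le> norm x * K"
    using bounded_linear.bounded[OF bounded_linear_op_apply] by blast
  have "norm (B y) \<le> norm y * K" for y
  proof (cases "B y = 0")
    case True
    \<comment> \<open>\<open>K\<close> may be negative on the zero space, so the sign is read off
      from the bound at \<open>y\<close> itself.\<close>
    have "0 \<le> norm y * K"
      using order_trans[OF norm_ge_zero K[of y]] .
    with True show ?thesis by simp
  next
    case False
    have "(norm (B y))\<^sup>2 = cmod (cinner (B y) (B y))"
      by (simp only: norm_cinner[symmetric] norm_of_real abs_power2)
    also have "\<dots> = cmod (cinner (op_apply A (B y)) y)"
      by (simp add: B)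
    also have "\<dots> \<le> norm (op_apply A (B y)) * norm y"
      by (rule cmod_cinner_le)
    also have "\<dots> \<le> norm (B y) * K * norm y"
      by (intro mult_right_mono K) simp
    finally have "norm (B y) * norm (B y) \<le> norm (B y) * (norm y * K)"
      by (simp add: power2_eq_square mult_ac)
    with False show ?thesis by simp
  qed
  then have "bounded_linear B"
    by (intro bounded_linear_intro[where K = K]) (auto simp: add scale scaleR_scaleC)
  then have "op_apply (Bounded_op B) = B"
    by (simp add: Bounded_op_inverse scale)
  then show ?thesis
    using B by metis
qed

text \<open>Evaluates the definite description: any operator satisfying the adjoint equation is the
  adjoint.\<close>

lemma op_adj_eqI:
  fixes A B :: "'a::complex_hilbert bounded_op"
  assumes "\<And>x y. cinner (op_apply A x) y = cinner x (op_apply B y)"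
  shows "op_adj A = B"
  unfolding op_adj_def
proof (rule the_equality)
  fix C
  assume "\<forall>x y. cinner (op_apply A x) y = cinner x (op_apply C y)"
  then have "cinner x (op_apply C y) = cinner x (op_apply B y)" for x y
    by (metis assms)
  then have "op_apply C y = op_apply B y" for y
    by (rule cinner_right_ext)
  then show "C = B"
    by (simp add: op_apply_inject[symmetric] fun_eq_iff)
qed (simp add: assms)

lemma cinner_op_adj: "cinner (op_apply A x) y = cinner x (op_apply (op_adj A) y)"
proof -
  obtain B where B: "\<And>x y. cinner (op_apply A x) y = cinner x (op_apply B y)"
    using adjoint_exists by blast
  then have "op_adj A = B"
    by (rule op_adj_eqI)
  with B show ?thesis by simp
qed

lemma op_adj_mult: "op_adj (A * B) = op_adj B * op_adj A"
  by (rule op_adj_eqI) (simp add: times_bounded_op.rep_eq cinner_op_adj)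

section \<open>The identity\<close>

lemma scaleC_mult_left: "(c *\<^sub>C A) * B = c *\<^sub>C (A * (B :: 'a::complex_hilbert bounded_op))"
  by transfer simp

lemma scaleC_mult_right: "A * (c *\<^sub>C B) = c *\<^sub>C (A * (B :: 'a::complex_hilbert bounded_op))"
  by transfer simp

lemma scaleC_minus_left: "(- c) *\<^sub>C x = - (c *\<^sub>C (x :: 'a::complex_vector))"
proof -
  have "0 *\<^sub>C x = 0"
    using scaleC_add_left[of 0 0 x] by simp
  then show ?thesis
    using scaleC_add_left[of "- c" c x] by (simp add: eq_neg_iff_add_eq_0)
qed

lemma op_Im_power2:
  "(op_Im A)\<^sup>2 = (- 1 / 4) *\<^sub>C (A - op_adj A)\<^sup>2"
  by (simp add: op_Im_def power2_eq_square scaleC_mult_left scaleC_mult_right scaleC_scaleC)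

text \<open>With \<open>B\<close> the adjoint, the coefficients of \<open>A * A\<close> and
  \<open>B * B\<close> are \<open>t\<^sup>2 - t\<close> and
  \<open>(1 - t)\<^sup>2 - (1 - t)\<close>, both equal to \<open>- (t * (1 - t))\<close>. The mixed
  products keep their order with coefficient \<open>t * (1 - t)\<close>, so the square of
  \<open>A - B\<close> appears without commutativity.\<close>

lemma weighted_Re_power2_diff:
  fixes A :: "'a::complex_hilbert bounded_op"
  shows "(weighted_Re t A)\<^sup>2 - weighted_Re t (A\<^sup>2)
    = of_real (- (t * (1 - t))) *\<^sub>C (A - op_adj A)\<^sup>2"
proof -
  define B where "B = op_adj A"
  define s where "s = complex_of_real t"
  define p where "p = s * (1 - s)"
  \<comment> \<open>Written as sums so that \<open>scaleC_add_left\<close> splits off exactly the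
    terms of \<open>weighted_Re t (A\<^sup>2)\<close>.\<close>
  have sq: "(1 - s) * (1 - s) = (1 - s) + - p" "s * s = s + - p"
    by (simp_all add: p_def algebra_simps)
  have "(weighted_Re t A)\<^sup>2
      = ((1 - s) * (1 - s)) *\<^sub>C (B * B) + (s * s) *\<^sub>C (A * A) + p *\<^sub>C (A * B + B * A)"
    by (simp add: weighted_Re_def power2_eq_square distrib_left distrib_right scaleC_mult_left
        scaleC_mult_right scaleC_scaleC scaleC_add_right add_ac mult.commute p_def flip: B_def s_def)
  also have "\<dots> = (1 - s) *\<^sub>C (B * B) + s *\<^sub>C (A * A) + (- p) *\<^sub>C (A - B)\<^sup>2"
    unfolding sq scaleC_add_left
    by (simp add: power2_eq_square left_diff_distrib right_diff_distrib scaleC_minus_left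
        scaleC_add_right scaleC_diff_right)
  finally show ?thesis
    by (simp add: weighted_Re_def power2_eq_square op_adj_mult p_def flip: B_def s_def)
qed

lemma scaled_weighted_Re_power2_diff:
  assumes "0 < t" "t < 1"
  shows "complex_of_real (1 / (4 * t * (1 - t))) *\<^sub>C ((weighted_Re t A)\<^sup>2 - weighted_Re t (A\<^sup>2))
    = (op_Im A)\<^sup>2"
proof -
  have "1 / (4 * t * (1 - t)) * (- (t * (1 - t))) = - 1 / 4"
    using assms by (simp add: field_simps)
  then have "complex_of_real (1 / (4 * t * (1 - t))) * of_real (- (t * (1 - t))) = - 1 / 4"
    by (simp only: flip: of_real_mult) simp
  then show ?thesis
    by (simp only: weighted_Re_power2_diff op_Im_power2 scaleC_scaleC)
qed

lemma weighted_Re_half: "weighted_Re (1 / 2) A = op_Re A"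
  by (simp add: weighted_Re_def op_Re_def scaleC_add_right add.commute)

theorem proposition1p1:
  fixes A :: "'a::complex_hilbert bounded_op"
  shows "(\<forall>t::real. 0 < t \<and> t < 1 \<longrightarrow>
            complex_of_real (1 / (4 * t * (1 - t))) *\<^sub>C ((weighted_Re t A)\<^sup>2 - weighted_Re t (A\<^sup>2))
              = (op_Im A)\<^sup>2)
         \<and> (op_Re A)\<^sup>2 - op_Re (A\<^sup>2) = (op_Im A)\<^sup>2"
proof (intro conjI allI impI)
  show "(op_Re A)\<^sup>2 - op_Re (A\<^sup>2) = (op_Im A)\<^sup>2"
    \<comment> \<open>At \<open>t = 1 / 2\<close> the factor \<open>4 * t * (1 - t)\<close> equals
      1.\<close>
    using scaled_weighted_Re_power2_diff[of "1 / 2" A] by (simp add: weighted_Re_half scaleC_one)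
qed (simp only: scaled_weighted_Re_power2_diff)

end
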